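(* Let $T,S\in\mathbb{P}$. Then: (i) $\binom{T}{S}=0$ if $\deg(S)>\deg(T)$. (ii) If $\deg(S)=\deg(T)$, then $\binom{T}{S}=1$ if $S=T$ and $\binom{T}{S}=0$ if $S\neq T$. (iii) $\binom{T}{\underline{1}}=1$, where $\underline{1}$ is the empty tree. (iv) $\binom{T}{x}=\deg(T)$, where $x$ is the tree with a single vertex. (v) $\binom{T}{x^2}=\binom{n}{2}$, where $n=\deg(T)$ and $x^2$ is the unique tree of degree $2$ in $\mathbb{P}$. (vi) For every integer $m\ge 0$, $\displaystyle\sum_{S\in\mathbb{P},\ \deg(S)=m}\binom{T}{S}=\binom{\deg(T)}{m}$.
   Context: $\mathbb{P}$ is the set of isomorphism classes of finite planar reduced rooted trees: finite rooted trees in which the children of every vertex are linearly ordered and no vertex has exactly one child (isomorphisms preserve root and orders). The empty tree $\underline{1}$ (no vertices) is included in $\mathbb{P}$. $L(T)$ is the set of leaves (vertices without children) of $T$ and $\deg(T)=\#L(T)$; so $\deg(\underline{1})=0$, and the tree $x$ with a single vertex has degree $1$. Contraction: for $I\subseteq L(T)$, $T|I$ is the tree in $\mathbb{P}$ obtained as follows. If $I=\emptyset$, then $T|I=\underline{1}$. Otherwise keep exactly the vertices of $T$ lying on a path from the root to a leaf in $I$, with the inherited planar order, and then suppress every vertex having exactly one child (if the root has exactly one child, delete it and let the child be the new root, repeatedly). The leaves of $T|I$ are the elements of $I$. Planar binomial coefficient (first kind): for $T,S\in\mathbb{P}$, $\binom{T}{S}$ is the number of subsets $I\subseteq L(T)$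 such that $T|I$ is isomorphic to $S$. For integers, $\binom{n}{m}$ is the usual binomial coefficient. *)

theory Defs
  imports Main
begin

text \<open>An element of the datatype is a finite rooted tree in which the children of every vertex are
  linearly ordered. Planar rooted trees have no nontrivial automorphisms, and equality on the
  datatype is isomorphism of planar rooted trees.\<close>

datatype ptree = Node "ptree list"

fun reduced :: "ptree \<Rightarrow> bool" where
  "reduced (Node ts) \<longleftrightarrow> length ts \<noteq> 1 \<and> (\<forall>t\<in>set ts. reduced t)"

text \<open>The value \<open>None\<close> is the empty tree.\<close>

definition PP :: "ptree option set" where
  "PP = insert None (Some ` {t. reduced t})"

lemma size_nth_ptree [termination_simp]:
  "i < length ts \<Longrightarrow> size (ts ! i) < Suc (size_list size ts)" for ts :: "ptree list"
  using size_list_estimation'[of "ts ! i" ts "size (ts ! i)" size] by (simp add: less_Suc_eq_le)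

text \<open>A vertex is represented by its address, the list of child indices on the path from the root.\<close>

fun tleaves :: "ptree \<Rightarrow> nat list set" where
  "tleaves (Node ts) =
     (if ts = [] then {[]} else \<Union>i\<in>{..<length ts}. (#) i ` tleaves (ts ! i))"

definition leaves :: "ptree option \<Rightarrow> nat list set" where
  "leaves T = (case T of None \<Rightarrow> {} | Some t \<Rightarrow> tleaves t)"

definition deg :: "ptree option \<Rightarrow> nat" where
  "deg T = card (leaves T)"

text \<open>For a nonempty set \<open>I\<close> of leaves of \<open>t\<close>, \<open>prune t I\<close> keeps the vertices lying on a path from
  the root to a leaf in \<open>I\<close>, that is, the addresses that are prefixes of elements of \<open>I\<close>.\<close>

fun prune :: "ptree \<Rightarrow> nat list set \<Rightarrow> ptree" where
  "prune (Node ts) I =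
     Node (map (\<lambda>i. prune (ts ! i) {p. i # p \<in> I})
       (filter (\<lambda>i. \<exists>p. i # p \<in> I) [0..<length ts]))"

fun suppress :: "ptree \<Rightarrow> ptree" where
  "suppress (Node ts) = (case map suppress ts of [t] \<Rightarrow> t | us \<Rightarrow> Node us)"

definition contract :: "ptree option \<Rightarrow> nat list set \<Rightarrow> ptree option" where
  "contract T I = (if I = {} then None else map_option (\<lambda>t. suppress (prune t I)) T)"

definition pbinom :: "ptree option \<Rightarrow> ptree option \<Rightarrow> nat" where
  "pbinom T S = card {I. I \<subseteq> leaves T \<and> contract T I = S}"

definition tree_x :: "ptree option" where
  "tree_x = Some (Node [])"

definition tree_x2 :: "ptree option" where
  "tree_x2 = Some (Node [Node [], Node []])"

lemma reduced_suppress: "reduced (suppress t)"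
proof (induction t rule: suppress.induct)
  case (1 ts)
  then show ?case by (auto split: list.split)
qed

lemma contract_in_PP: "contract T I \<in> PP"
  by (cases T) (auto simp: contract_def PP_def reduced_suppress)

lemma finite_tleaves: "finite (tleaves t)"
  by (induction t rule: tleaves.induct) auto

lemma tleaves_nonempty: "tleaves t \<noteq> {}"
  by (induction t rule: tleaves.induct) auto

lemma card_tleaves_pos: "card (tleaves t) > 0"
  by (simp add: card_gt_0_iff finite_tleaves tleaves_nonempty)

lemma card_tleaves:
  assumes "ts \<noteq> []"
  shows "card (tleaves (Node ts)) = (\<Sum>i<length ts. card (tleaves (ts ! i)))"
proof -
  have "card (\<Union>i\<in>{..<length ts}. (#) i ` tleaves (ts ! i)) =
      (\<Sum>i<length ts. card ((#) i ` tleaves (ts ! i)))"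
    by (rule card_UN_disjoint) (auto simp: finite_tleaves)
  then show ?thesis using assms by (simp add: card_image)
qed

lemma length_le_card_tleaves: "length ts \<le> card (tleaves (Node ts))"
proof (cases "ts = []")
  case False
  have "(\<Sum>i<length ts. 1) \<le> (\<Sum>i<length ts. card (tleaves (ts ! i)))"
    by (rule sum_mono) (simp add: Suc_le_eq card_tleaves_pos)
  then show ?thesis using card_tleaves[OF False] by simp
qed simp

lemma card_tleaves_child:
  assumes "length ts \<ge> 2" "t \<in> set ts"
  shows "card (tleaves t) < card (tleaves (Node ts))"
proof -
  obtain i where i: "i < length ts" "t = ts ! i" using assms(2) by (metis in_set_conv_nth)
  obtain j where j: "j < length ts" "j \<noteq> i"
    using assms(1) that[of 0] that[of 1] by (cases "i = 0") fastforce+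
  have "(\<Sum>k\<in>{i, j}. card (tleaves (ts ! k))) \<le> (\<Sum>k<length ts. card (tleaves (ts ! k)))"
    using i j by (intro sum_mono2) auto
  moreover have "ts \<noteq> []" using assms by auto
  ultimately show ?thesis using i j card_tleaves[of ts] card_tleaves_pos[of "ts ! j"] by simp
qed

lemma finite_reduced: "finite {t. reduced t \<and> card (tleaves t) \<le> n}"
proof (induction n)
  case 0
  have "{t. reduced t \<and> card (tleaves t) \<le> 0} = {}"
    using card_tleaves_pos by (metis (lifting) empty_Collect_eq not_le)
  then show ?case by (simp only: finite.emptyI)
next
  case (Suc n)
  let ?A = "{t. reduced t \<and> card (tleaves t) \<le> n}"
  have "t \<in> insert (Node []) (Node ` {ts. set ts \<subseteq> ?A \<and> length ts \<le> Suc n})"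
    if "reduced t" "card (tleaves t) \<le> Suc n" for t
  proof (cases t)
    case (Node ts)
    show ?thesis
    proof (cases "ts = []")
      case False
      then have "length ts \<ge> 2" using that(1) Node by (cases "length ts") auto
      then have "set ts \<subseteq> ?A"
        using that Node card_tleaves_child[of ts] by (force simp del: tleaves.simps)
      moreover have "length ts \<le> Suc n" using that Node length_le_card_tleaves[of ts] by (simp del: tleaves.simps)
      ultimately show ?thesis using Node by blast
    qed (use Node in simp)
  qed
  then have "{t. reduced t \<and> card (tleaves t) \<le> Suc n} \<subseteq>
      insert (Node []) (Node ` {ts. set ts \<subseteq> ?A \<and> length ts \<le> Suc n})"
    by blast
  moreover have "finite (insert (Node []) (Node ` {ts. set ts \<subseteq> ?A \<and> length ts \<le> Suc n}))"
    using Suc finite_lists_length_le by blast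
  ultimately show ?case by (rule finite_subset)
qed

lemma finite_PP_deg: "finite {S \<in> PP. deg S = m}"
proof -
  have "{S \<in> PP. deg S = m} \<subseteq> insert None (Some ` {t. reduced t \<and> card (tleaves t) \<le> m})"
    by (auto simp: PP_def deg_def leaves_def)
  then show ?thesis using finite_reduced finite_subset by blast
qed

lemma reduced_card_tleaves_1:
  assumes "reduced t" "card (tleaves t) \<le> 1"
  shows "t = Node []"
proof (cases t)
  case (Node ts)
  have "length ts \<le> 1" using length_le_card_tleaves[of ts] assms Node by (simp del: tleaves.simps)
  then show ?thesis using assms Node by (cases ts) (auto simp del: tleaves.simps)
qed

lemma PP_deg_2_iff: "S \<in> PP \<and> deg S = 2 \<longleftrightarrow> S = tree_x2"
proof
  assume S: "S \<in> PP \<and> deg S = 2"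
  then obtain t where t: "S = Some t" "reduced t" "card (tleaves t) = 2"
    by (cases S) (auto simp: PP_def deg_def leaves_def)
  obtain ts where "t = Node ts" by (cases t)
  with t have ts: "S = Some (Node ts)" "reduced (Node ts)" "card (tleaves (Node ts)) = 2"
    by (simp_all del: tleaves.simps)
  have "ts \<noteq> []" using ts(3) by auto
  moreover have "length ts \<noteq> 1" using ts(2) by simp
  moreover have "length ts \<le> 2" using length_le_card_tleaves[of ts] ts(3) by (simp del: tleaves.simps)
  ultimately have len: "length ts = 2"
    by (metis One_nat_def Suc_1 le_SucE le_zero_eq length_0_conv)
  have "t = Node []" if "t \<in> set ts" for t
    using reduced_card_tleaves_1[of t] card_tleaves_child[of ts t] len ts that by (simp del: tleaves.simps)
  then have "ts = [Node [], Node []]"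
    using len by (auto simp: numeral_2_eq_2 length_Suc_conv)
  then show "S = tree_x2" using ts by (simp add: tree_x2_def)
next
  assume "S = tree_x2"
  then show "S \<in> PP \<and> deg S = 2"
    using card_tleaves[of "[Node [], Node []]"]
    by (simp add: tree_x2_def PP_def deg_def leaves_def numeral_2_eq_2 del: tleaves.simps) (simp)
qed

end

theory Submission
  imports Defs
begin

text \<open>Contraction to \<open>I\<close> yields a tree with \<open>card I\<close> leaves, so the contractions of degree \<open>m\<close> come
  exactly from the \<open>m\<close>-element sets of leaves, and contraction to the set of all leaves gives the
  tree back. Everything follows by counting, since there is only one tree in each of the
  degrees 0, 1 and 2.\<close>

lemma card_tleaves_sum_list:
  assumes "ts \<noteq> []"
  shows "card (tleaves (Node ts)) = (\<Sum>t\<leftarrow>ts. card (tleaves t))"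
  by (simp only: card_tleaves[OF assms] sum_list_sum_nth) (simp add: atLeast0LessThan)

text \<open>Leaf counts add up over the children, so a vertex with a single child has as many leaves
  as that child and can be replaced by it.\<close>

lemma card_tleaves_suppress: "card (tleaves (suppress t)) = card (tleaves t)"
proof (induction t rule: suppress.induct)
  case (1 ts)
  show ?case
  proof (cases "ts = []")
    case False
    let ?us = "map suppress ts"
    have "card (tleaves (suppress (Node ts))) = (\<Sum>u\<leftarrow>?us. card (tleaves u))"
    proof (cases "\<exists>u. ?us = [u]")
      case True
      then obtain u where u: "?us = [u]" ..
      show ?thesis by (simp only: suppress.simps u) simp
    next
      case nonsingleton: False
      then have "suppress (Node ts) = Node ?us"
        by (simp split: list.split)
      then show ?thesis
        using False by (simp del: tleaves.simps suppress.simps add: card_tleaves_sum_list o_def)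
    qed
    also have "\<dots> = (\<Sum>t\<leftarrow>ts. card (tleaves t))"
      using 1 by (simp add: o_def cong: map_cong)
    finally show ?thesis by (simp only: card_tleaves_sum_list[OF False])
  qed simp
qed

text \<open>\<open>I\<close> splits by first index into the sets \<open>?J i\<close>, and exactly
  the children with nonempty \<open>?J i\<close> survive, so induction applies to each of them. For
  empty \<open>I\<close> the equation fails: the root would remain as a leaf.\<close>

lemma card_tleaves_prune:
  assumes "I \<subseteq> tleaves t" "I \<noteq> {}"
  shows "card (tleaves (prune t I)) = card I"
  using assms
proof (induction t I rule: prune.induct)
  case (1 ts I)
  show ?case
  proof (cases "ts = []")
    case True
    then have "I = {[]}" using 1 by auto
    then show ?thesis using True by simp
  next
    case False
    let ?J = "\<lambda>i. {p. i # p \<in> I}"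
    let ?js = "filter (\<lambda>i. \<exists>p. i # p \<in> I) [0..<length ts]"
    have J: "?J i \<subseteq> tleaves (ts ! i)" if "i < length ts" for i
      using 1(2) False that by auto
    \<comment> \<open>As \<open>ts\<close> is nonempty, the root is not a leaf and every address in
      \<open>I\<close> starts with a child index.\<close>
    have I: "I = (\<Union>i\<in>set ?js. (#) i ` ?J i)"
      using 1(2) False by (fastforce simp: image_iff)
    then have js: "?js \<noteq> []" using 1(3) by force
    have "card (tleaves (prune (Node ts) I)) = (\<Sum>i\<leftarrow>?js. card (tleaves (prune (ts ! i) (?J i))))"
      using js by (simp del: tleaves.simps add: card_tleaves_sum_list o_def)
    also have "\<dots> = (\<Sum>i\<leftarrow>?js. card (?J i))"
      by (intro arg_cong[of _ _ sum_list] map_cong refl 1(1)) (use J in auto)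
    also have "\<dots> = (\<Sum>i\<in>set ?js. card ((#) i ` ?J i))"
      by (simp add: sum_list_distinct_conv_sum_set card_image del: set_filter)
    also have "\<dots> = card (\<Union>i\<in>set ?js. (#) i ` ?J i)"
      by (rule card_UN_disjoint[symmetric])
        (use J in \<open>auto intro!: finite_imageI intro: finite_subset[OF _ finite_tleaves]\<close>)
    finally show ?thesis using I by simp
  qed
qed

text \<open>Every subtree contains a leaf, so the filter discards no child.\<close>

lemma prune_tleaves: "prune t (tleaves t) = t"
proof (induction t rule: tleaves.induct)
  case (1 ts)
  show ?case
  proof (cases "ts = []")
    case False
    have J: "{p. i # p \<in> tleaves (Node ts)} = tleaves (ts ! i)" if "i < length ts" for i
      using False that by auto
    then have "filter (\<lambda>i. \<exists>p. i # p \<in> tleaves (Node ts)) [0..<length ts] = [0..<length ts]"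
      using tleaves_nonempty by (intro filter_True ballI) fastforce
    then have "prune (Node ts) (tleaves (Node ts)) =
        Node (map (\<lambda>i. prune (ts ! i) {p. i # p \<in> tleaves (Node ts)}) [0..<length ts])"
      by (simp only: prune.simps)
    also have "\<dots> = Node (map (\<lambda>i. ts ! i) [0..<length ts])"
      using 1 False J by (simp del: tleaves.simps)
    finally show ?thesis by (simp only: map_nth)
  qed simp
qed

lemma suppress_reduced: "reduced t \<Longrightarrow> suppress t = t"
proof (induction t rule: suppress.induct)
  case (1 ts)
  then have "map suppress ts = ts" by (simp add: map_idI)
  with 1(2) show ?case by (auto split: list.split simp del: map_eq_conv)
qed

text \<open>The empty set, excluded for \<open>prune\<close>, is covered by the separate clause of
  \<open>contract\<close>, which yields the empty tree of degree 0.\<close>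

lemma deg_contract:
  assumes "I \<subseteq> leaves T"
  shows "deg (contract T I) = card I"
proof (cases T)
  case None
  then show ?thesis using assms by (simp add: contract_def deg_def leaves_def)
next
  case (Some t)
  then show ?thesis using assms
    by (simp add: contract_def deg_def leaves_def card_tleaves_suppress card_tleaves_prune)
qed

lemma contract_leaves:
  assumes "T \<in> PP"
  shows "contract T (leaves T) = T"
  using assms tleaves_nonempty
  by (auto simp: PP_def contract_def leaves_def prune_tleaves suppress_reduced)

lemma finite_leaves: "finite (leaves T)"
  by (simp add: leaves_def finite_tleaves split: option.split)

text \<open>The fibres of \<open>contract T\<close> over the trees of degree \<open>m\<close>
  partition the \<open>m\<close>-element sets of leaves.\<close>

lemma sum_pbinom: "(\<Sum>S \<in> {S \<in> PP. deg S = m}. pbinom T S) = deg T choose m"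
proof -
  let ?P = "{S \<in> PP. deg S = m}"
  let ?F = "\<lambda>S. {I. I \<subseteq> leaves T \<and> contract T I = S}"
  have "(\<Sum>S \<in> ?P. pbinom T S) = card (\<Union>S\<in>?P. ?F S)"
    unfolding pbinom_def
    by (rule card_UN_disjoint[symmetric]) (auto simp: finite_PP_deg finite_leaves)
  also have "(\<Union>S\<in>?P. ?F S) = {I. I \<subseteq> leaves T \<and> card I = m}"
    using deg_contract contract_in_PP by auto
  finally show ?thesis by (simp add: n_subsets finite_leaves deg_def)
qed

text \<open>If \<open>S\<close> is the only tree of its degree, the sum in \<open>sum_pbinom\<close>
  has a single term.\<close>

lemma pbinom_unique:
  assumes "\<And>S'. S' \<in> PP \<and> deg S' = m \<longleftrightarrow> S' = S"
  shows "pbinom T S = deg T choose m"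
  using sum_pbinom[of T m] by (simp add: assms)

lemma PP_deg_0_iff: "S \<in> PP \<and> deg S = 0 \<longleftrightarrow> S = None"
  using card_tleaves_pos by (cases S) (auto simp: PP_def deg_def leaves_def)

lemma PP_deg_1_iff: "S \<in> PP \<and> deg S = 1 \<longleftrightarrow> S = tree_x"
  by (cases S) (auto simp: PP_def deg_def leaves_def tree_x_def dest: reduced_card_tleaves_1)

lemma pbinom_eq_0:
  assumes "deg S > deg T"
  shows "pbinom T S = 0"
proof -
  have "contract T I \<noteq> S" if "I \<subseteq> leaves T" for I
    using assms deg_contract[OF that] card_mono[OF finite_leaves that] by (auto simp: deg_def)
  then have "{I. I \<subseteq> leaves T \<and> contract T I = S} = {}" by blast
  then show ?thesis by (simp only: pbinom_def card.empty)
qed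

lemma pbinom_eq_deg:
  assumes "T \<in> PP" "deg S = deg T"
  shows "pbinom T S = (if S = T then 1 else 0)"
proof -
  \<comment> \<open>Comparing degrees, \<open>I\<close> has as many elements as the finite set
    \<open>leaves T\<close> and hence equals it; contraction to all leaves then returns
    \<open>T\<close>.\<close>
  have "contract T I = S \<longleftrightarrow> I = leaves T \<and> S = T" if "I \<subseteq> leaves T" for I
    using assms deg_contract[OF that] contract_leaves card_subset_eq[OF finite_leaves that]
    by (auto simp: deg_def)
  then have "{I. I \<subseteq> leaves T \<and> contract T I = S} = (if S = T then {leaves T} else {})"
    by auto
  then show ?thesis by (simp add: pbinom_def)
qed

theorem proposition2p2:
  fixes T S :: "ptree option"
  assumes "T \<in> PP" and "S \<in> PP"
  shows "(deg S > deg T \<longrightarrow> pbinom T S = 0) \<and>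
    (deg S = deg T \<longrightarrow> (S = T \<longrightarrow> pbinom T S = 1) \<and> (S \<noteq> T \<longrightarrow> pbinom T S = 0)) \<and>
    pbinom T None = 1 \<and>
    pbinom T tree_x = deg T \<and>
    pbinom T tree_x2 = deg T choose 2 \<and>
    (\<forall>m::nat. (\<Sum>S' \<in> {S' \<in> PP. deg S' = m}. pbinom T S') = deg T choose m)"
  \<comment> \<open>The values at the empty tree and at \<open>tree_x\<close> come out as
    \<open>deg T choose 0\<close> and \<open>deg T choose 1\<close>, which simplify to 1 and
    \<open>deg T\<close>.\<close>
  using pbinom_eq_0 pbinom_eq_deg[OF assms(1)] sum_pbinom
    pbinom_unique[OF PP_deg_0_iff] pbinom_unique[OF PP_deg_1_iff] pbinom_unique[OF PP_deg_2_iff]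
  by simp

end
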